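(* Let $\mathcal{H}$ be a set of graphs and let $G$ be an $\mathrm{fs}(\mathcal{H})$-free graph that is not critically $\mathcal{H}$-exist. Then $G$ is $\mathcal{H}$-free if and only if every $G$-contraction is $\mathcal{H}$-free.
   Context: All graphs are finite and simple. For a set of graphs $\mathcal{F}$, a graph is $\mathcal{F}$-free if none of its induced subgraphs is isomorphic to a graph in $\mathcal{F}$, and $\mathcal{F}$-exist otherwise. For an edge $e=uv$ of $G$, the contraction $G/e$ is obtained from $G$ by deleting $u,v$ and adding a new vertex adjacent to every vertex of $(N(u)\cup N(v))\setminus\{u,v\}$; a $G$-contraction is any $G/e$ with $e\in E(G)$. A graph $G$ is critically $\mathcal{H}$-exist if it is $\mathcal{H}$-exist and every $G$-contraction is $\mathcal{H}$-free. A graph $J$ is $\mathcal{H}$-free-split if $J$ is $\mathcal{H}$-free and some $J$-contraction is isomorphic to a graph in $\mathcal{H}$; $\mathrm{fs}(\mathcal{H})$ is the set of all $\mathcal{H}$-free-split graphs. *)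

theory Defs
  imports "Graph_Theory.Pair_Digraph" "Graph_Theory.Digraph_Isomorphism"
begin

text \<open>
  A finite simple graph is a \<^locale>\<open>pair_graph\<close>: a finite, symmetric, loop-free digraph without
  parallel arcs, in which an edge \<open>uv\<close> is the pair of arcs \<open>(u,v)\<close>, \<open>(v,u)\<close>. The null graph is
  allowed. Isomorphism is \<^const>\<open>digraph_iso\<close> and relates graphs over possibly different vertex types.
\<close>

lemma digraph_iso_with_proj_iff:
  assumes "pair_graph G"
  shows "digraph_iso (with_proj G) (with_proj H) \<longleftrightarrow>
    (\<exists>f. bij_betw f (pverts G) (pverts H) \<and> parcs H = map_prod f f ` parcs G)"
    (is "?L \<longleftrightarrow> ?R")
proof
  interpret pair_graph G by fact
  assume ?L
  then obtain h where h: "pre_digraph.digraph_isomorphism (with_proj G) h"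
    and H: "with_proj H = app_iso h (with_proj G)"
    unfolding digraph_iso_def by blast
  have ends: "fst = iso_tail h" "snd = iso_head h"
    and V: "pverts H = iso_verts h ` pverts G" and A: "parcs H = iso_arcs h ` parcs G"
    using H by (auto simp: with_proj_def app_iso_def)
  have arc: "iso_arcs h a = map_prod (iso_verts h) (iso_verts h) a" if "a \<in> parcs G" for a
    using h that ends by (auto simp: pre_digraph.digraph_isomorphism_def prod_eq_iff)
  have "bij_betw (iso_verts h) (pverts G) (pverts H)"
    using h V by (simp add: pre_digraph.digraph_isomorphism_def bij_betw_def)
  moreover have "parcs H = map_prod (iso_verts h) (iso_verts h) ` parcs G"
    using A arc by (auto intro: image_cong)
  ultimately show ?R by blast
next
  interpret pair_graph G by fact
  assume ?R
  then obtain f where f: "bij_betw f (pverts G) (pverts H)"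
    and A: "parcs H = map_prod f f ` parcs G" by blast
  define h where "h = \<lparr>iso_verts = f, iso_arcs = map_prod f f, iso_head = snd, iso_tail = fst\<rparr>"
  have "inj_on (map_prod f f) (parcs G)"
  proof (rule inj_onI)
    fix a b assume "a \<in> parcs G" "b \<in> parcs G" "map_prod f f a = map_prod f f b"
    then show "a = b"
      using bij_betw_imp_inj_on[OF f] arc_fst_in_verts arc_snd_in_verts
      by (auto simp: inj_on_def prod_eq_iff)
  qed
  moreover have "wf_digraph (with_proj G)" by unfold_locales
  ultimately have "pre_digraph.digraph_isomorphism (with_proj G) h"
    using f by (simp add: pre_digraph.digraph_isomorphism_def h_def bij_betw_def)
  moreover have "with_proj H = app_iso h (with_proj G)"
    using f A by (simp add: with_proj_def app_iso_def h_def bij_betw_def)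
  ultimately show ?L unfolding digraph_iso_def by blast
qed

definition graph_free :: "'h pair_pre_digraph set \<Rightarrow> 'a pair_pre_digraph \<Rightarrow> bool" where
  "graph_free \<F> G \<longleftrightarrow>
    \<not> (\<exists>I H. induced_subgraph (with_proj I) (with_proj G) \<and> H \<in> \<F> \<and>
             digraph_iso (with_proj I) (with_proj H))"

definition graph_exist :: "'h pair_pre_digraph set \<Rightarrow> 'a pair_pre_digraph \<Rightarrow> bool" where
  "graph_exist \<F> G \<longleftrightarrow> \<not> graph_free \<F> G"

definition neighborhood :: "'a pair_pre_digraph \<Rightarrow> 'a \<Rightarrow> 'a set" where
  "neighborhood G u = {w. (u, w) \<in> parcs G}"

text \<open>
  The contraction lives on the option type: \<open>None\<close> is the new vertex and \<open>Some x\<close> is an old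
  vertex \<open>x\<close>, so that the new vertex is guaranteed to be fresh.
\<close>

definition contract_edge :: "'a pair_pre_digraph \<Rightarrow> 'a \<times> 'a \<Rightarrow> 'a option pair_pre_digraph" where
  "contract_edge G = (\<lambda>(u, v).
    let N = neighborhood G u \<union> neighborhood G v - {u, v} in
    \<lparr> pverts = insert None (Some ` (pverts G - {u, v})),
      parcs = {(Some x, Some y) | x y. (x, y) \<in> parcs G \<and> x \<notin> {u, v} \<and> y \<notin> {u, v}}
        \<union> {(None, Some x) | x. x \<in> N} \<union> {(Some x, None) | x. x \<in> N} \<rparr>)"

definition contractions :: "'a pair_pre_digraph \<Rightarrow> 'a option pair_pre_digraph set" where
  "contractions G = {contract_edge G e | e. e \<in> parcs G}"

lemma pair_graph_contract_edge:
  assumes "pair_graph G" and "e \<in> parcs G"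
  shows "pair_graph (contract_edge G e)"
proof -
  interpret pair_graph G by fact
  obtain u v where e: "e = (u, v)" by (cases e)
  let ?C = "contract_edge G e"
  have V: "finite (pverts ?C)"
    using pair_finite_verts by (auto simp: contract_edge_def e Let_def)
  have A: "parcs ?C \<subseteq> pverts ?C \<times> pverts ?C"
    by (auto simp: contract_edge_def e Let_def neighborhood_def dest: wellformed')
  have "finite (parcs ?C)"
    using finite_subset[OF A] V by blast
  moreover have "sym (parcs ?C)"
    by (rule symI) (auto simp: contract_edge_def e Let_def intro: arcs_symmetric)
  moreover have "fst a \<noteq> snd a" if "a \<in> parcs ?C" for a
    using that by (auto simp: contract_edge_def e Let_def dest: no_loops')
  ultimately show ?thesis
    using V A by unfold_locales (auto simp: symmetric_def)
qed

definition critically_exist :: "'h pair_pre_digraph set \<Rightarrow> 'a pair_pre_digraph \<Rightarrow> bool" where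
  "critically_exist \<H> G \<longleftrightarrow> graph_exist \<H> G \<and> (\<forall>C \<in> contractions G. graph_free \<H> C)"

definition free_split :: "'h pair_pre_digraph set \<Rightarrow> 'a pair_pre_digraph \<Rightarrow> bool" where
  "free_split \<H> J \<longleftrightarrow> pair_graph J \<and> graph_free \<H> J \<and>
    (\<exists>C \<in> contractions J. \<exists>H \<in> \<H>. digraph_iso (with_proj C) (with_proj H))"

text \<open>
  Being free-split is invariant under isomorphism and every finite graph is isomorphic to one with
  vertices in \<^typ>\<open>nat\<close>; hence the set below contains a copy of every free-split graph, over
  whatever vertex type.
\<close>

definition fs :: "'h pair_pre_digraph set \<Rightarrow> nat pair_pre_digraph set" where
  "fs \<H> = {J. free_split \<H> J}"

end

theory Submission
  imports Defs
begin

text \<open>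
  Suppose that \<open>G\<close> is \<open>\<H>\<close>-free but some contraction of \<open>G\<close> along \<open>uv\<close> contains an induced copy
  of \<open>H \<in> \<H>\<close>. The copy uses the new vertex, since otherwise it would lie in \<open>G\<close>. Replacing the new
  vertex by \<open>u\<close> and \<open>v\<close> gives an induced subgraph of \<open>G\<close> that is \<open>\<H>\<close>-free and whose contraction
  along \<open>uv\<close> is \<open>H\<close>, so it is an \<open>\<H>\<close>-free-split graph inside the \<open>fs(\<H>)\<close>-free graph \<open>G\<close>. The
  converse is just the failure of \<open>G\<close> to be critically \<open>\<H>\<close>-exist.
\<close>

text \<open>An injection from pattern to host that preserves and reflects arcs composes freely and
  carries over to contractions, even when every graph has its own vertex type. Values of
  \<open>g\<close> outside \<open>pverts H\<close> are irrelevant.\<close>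

definition induced_embedding :: "('b \<Rightarrow> 'a) \<Rightarrow> 'b pair_pre_digraph \<Rightarrow> 'a pair_pre_digraph \<Rightarrow> bool"
  where "induced_embedding g H G \<longleftrightarrow> inj_on g (pverts H) \<and> g ` pverts H \<subseteq> pverts G \<and>
    (\<forall>x \<in> pverts H. \<forall>y \<in> pverts H. (g x, g y) \<in> parcs G \<longleftrightarrow> (x, y) \<in> parcs H)"

lemma pair_graph_parcs_subset: "pair_graph G \<Longrightarrow> parcs G \<subseteq> pverts G \<times> pverts G"
proof -
  assume "pair_graph G"
  then interpret pair_graph G .
  show ?thesis by (auto dest: wellformed')
qed

lemma induced_embedding_comp:
  assumes "induced_embedding f A B" and "induced_embedding g B C"
  shows "induced_embedding (g \<circ> f) A C"
  using assms unfolding induced_embedding_def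
  by (auto intro!: comp_inj_on intro: inj_on_subset simp: image_subset_iff)

text \<open>Used with the identity, to get induced subgraphs, and with a numbering of vertices, to
  get copies on natural numbers. Symmetry and the absence of loops are inherited because each arc is
  tested on its image in \<open>G\<close>.\<close>

lemma pair_graph_pullback:
  assumes "pair_graph G" and "finite T" and "k ` T \<subseteq> pverts G"
  shows "pair_graph \<lparr>pverts = T, parcs = {(x, y). x \<in> T \<and> y \<in> T \<and> (k x, k y) \<in> parcs G}\<rparr>"
    (is "pair_graph ?K")
proof -
  interpret pair_graph G by fact
  have A: "parcs ?K \<subseteq> T \<times> T" by auto
  have "finite (parcs ?K)" using finite_subset[OF A] assms(2) by blast
  moreover have "sym (parcs ?K)" by (rule symI) (auto intro: arcs_symmetric)
  moreover have "fst a \<noteq> snd a" if "a \<in> parcs ?K" for a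
    using that by (auto dest: no_loops')
  ultimately show ?thesis
    using A assms(2) by unfold_locales (auto simp: symmetric_def)
qed

text \<open>Both graphs are copies of the subgraph that \<open>C\<close> induces on the common
  image: go into \<open>C\<close> along \<open>f\<close> and come back along the inverse of
  \<open>g\<close>.\<close>

lemma digraph_iso_if_same_image:
  assumes "pair_graph A" and "pair_graph B"
    and f: "induced_embedding f A C" and g: "induced_embedding g B C"
    and image: "f ` pverts A = g ` pverts B"
  shows "digraph_iso (with_proj A) (with_proj B)"
proof -
  define h where "h = inv_into (pverts B) g \<circ> f"
  have gh: "g (h x) = f x" "h x \<in> pverts B" if "x \<in> pverts A" for x
  proof -
    have "f x \<in> g ` pverts B" using that image by blast
    then show "g (h x) = f x" "h x \<in> pverts B"
      by (auto simp: h_def f_inv_into_f inv_into_into)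
  qed
  have bij: "bij_betw h (pverts A) (pverts B)"
    unfolding h_def
  proof (rule bij_betw_trans)
    show "bij_betw f (pverts A) (g ` pverts B)"
      using f image by (simp add: induced_embedding_def bij_betw_def)
    show "bij_betw (inv_into (pverts B) g) (g ` pverts B) (pverts B)"
      using g by (intro bij_betw_inv_into) (simp add: induced_embedding_def bij_betw_def)
  qed
  have arc: "(h x, h y) \<in> parcs B \<longleftrightarrow> (x, y) \<in> parcs A" if "x \<in> pverts A" "y \<in> pverts A" for x y
  proof -
    have "(g (h x), g (h y)) \<in> parcs C \<longleftrightarrow> (h x, h y) \<in> parcs B"
      using g gh(2)[OF that(1)] gh(2)[OF that(2)] unfolding induced_embedding_def by blast
    moreover have "(f x, f y) \<in> parcs C \<longleftrightarrow> (x, y) \<in> parcs A"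
      using f that unfolding induced_embedding_def by blast
    ultimately show ?thesis using gh(1)[OF that(1)] gh(1)[OF that(2)] by simp
  qed
  have "parcs B = map_prod h h ` parcs A"
  proof (intro set_eqI iffI)
    fix e assume e: "e \<in> parcs B"
    obtain p q where pq: "e = (p, q)" by (cases e)
    have "p \<in> h ` pverts A" "q \<in> h ` pverts A"
      using e pq bij pair_graph_parcs_subset[OF assms(2)] by (auto simp: bij_betw_def)
    then show "e \<in> map_prod h h ` parcs A" using e pq arc by force
  next
    fix e assume "e \<in> map_prod h h ` parcs A"
    then show "e \<in> parcs B"
      using arc pair_graph_parcs_subset[OF assms(1)] by fastforce
  qed
  then show ?thesis using bij digraph_iso_with_proj_iff[OF assms(1)] by blast
qed

text \<open>The bridge from freeness, stated with subgraphs and isomorphisms, to embeddings, which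
  the rest of the argument handles.\<close>

lemma graph_free_iff_no_induced_embedding:
  assumes G: "pair_graph G" and F: "\<forall>H \<in> \<F>. pair_graph H"
  shows "graph_free \<F> G \<longleftrightarrow> \<not> (\<exists>H \<in> \<F>. \<exists>g. induced_embedding g H G)"
proof -
  have "\<exists>g. induced_embedding g H G"
    if I: "induced_subgraph (with_proj I) (with_proj G)" and H: "H \<in> \<F>"
      and iso: "digraph_iso (with_proj I) (with_proj H)" for I :: "'a pair_pre_digraph" and H
  proof -
    have V: "pverts I \<subseteq> pverts G" and
      A: "parcs I = {(x, y). x \<in> pverts I \<and> y \<in> pverts I \<and> (x, y) \<in> parcs G}"
      using I by (auto simp: induced_subgraph_def subgraph_def)
    interpret G: pair_graph G by fact
    \<comment> \<open>\<open>I\<close> is the restriction of \<open>G\<close> to a subset of its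
      vertices, that is, a pullback along the identity.\<close>
    have "pair_graph I"
    proof -
      have "finite (pverts I)" using V G.pair_finite_verts finite_subset by blast
      then have "pair_graph \<lparr>pverts = pverts I, parcs = parcs I\<rparr>"
        using pair_graph_pullback[OF G, of "pverts I" "\<lambda>x. x"] V A by simp
      moreover have "\<lparr>pverts = pverts I, parcs = parcs I\<rparr> = I"
        by (rule pair_pre_digraph.equality) simp_all
      ultimately show ?thesis by (rule back_subst)
    qed
    then obtain f where f: "bij_betw f (pverts I) (pverts H)"
      and AH: "parcs H = map_prod f f ` parcs I"
      using iso digraph_iso_with_proj_iff[of I H] by auto
    have arc: "(f x, f y) \<in> parcs H \<longleftrightarrow> (x, y) \<in> parcs G" if "x \<in> pverts I" "y \<in> pverts I" for x y
    proof
      assume "(f x, f y) \<in> parcs H"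
      then obtain p q where "(p, q) \<in> parcs I" "f p = f x" "f q = f y" unfolding AH by auto
      moreover from this have "p = x" "q = y"
        using that A bij_betw_imp_inj_on[OF f] by (auto dest: inj_onD)
      ultimately show "(x, y) \<in> parcs G" using A by simp
    next
      assume "(x, y) \<in> parcs G"
      then have "(x, y) \<in> parcs I" using that A by simp
      then show "(f x, f y) \<in> parcs H" unfolding AH by (rule rev_image_eqI) simp
    qed
    \<comment> \<open>The isomorphism runs from \<open>I\<close> to \<open>H\<close>; its inverse
      places \<open>H\<close> inside \<open>G\<close>.\<close>
    define g where "g = inv_into (pverts I) f"
    have g: "bij_betw g (pverts H) (pverts I)" unfolding g_def using f by (rule bij_betw_inv_into)
    have fg: "f (g x) = x" "g x \<in> pverts I" if "x \<in> pverts H" for x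
      using that bij_betw_inv_into_right[OF f] bij_betwE[OF g] unfolding g_def by blast+
    have "induced_embedding g H G"
      unfolding induced_embedding_def
    proof (intro conjI ballI)
      show "inj_on g (pverts H)" using g by (rule bij_betw_imp_inj_on)
      show "g ` pverts H \<subseteq> pverts G" using V fg by blast
      show "(g x, g y) \<in> parcs G \<longleftrightarrow> (x, y) \<in> parcs H" if "x \<in> pverts H" "y \<in> pverts H" for x y
        using arc[of "g x" "g y"] fg that by simp
    qed
    then show ?thesis by blast
  qed
  moreover have "\<exists>I. induced_subgraph (with_proj I) (with_proj G) \<and>
      digraph_iso (with_proj I) (with_proj H)"
    if H: "H \<in> \<F>" and g: "induced_embedding g H G" for H g
  proof -
    interpret G: pair_graph G by fact
    define S where "S = g ` pverts H"
    define I where "I = \<lparr>pverts = S, parcs = {(x, y). x \<in> S \<and> y \<in> S \<and> (x, y) \<in> parcs G}\<rparr>"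
    have S: "S \<subseteq> pverts G" using g by (simp add: S_def induced_embedding_def)
    then have "finite S" using G.pair_finite_verts finite_subset by blast
    then have I: "pair_graph I"
      using pair_graph_pullback[OF G, of S "\<lambda>x. x"] S by (simp add: I_def)
    then interpret I: pair_graph I .
    have "induced_subgraph (with_proj I) (with_proj G)"
      using S I.wf_digraph G.wf_digraph
      by (auto simp: induced_subgraph_def subgraph_def compatible_def I_def)
    \<comment> \<open>The inclusion of \<open>I\<close> and the embedding \<open>g\<close> have the
      same image \<open>S\<close> in \<open>G\<close>, so \<open>I\<close> and \<open>H\<close> are
      isomorphic.\<close>
    moreover have "induced_embedding (\<lambda>x. x) I G"
      using S by (auto simp: induced_embedding_def I_def)
    then have "digraph_iso (with_proj I) (with_proj H)"
      using digraph_iso_if_same_image[OF I _ _ g] F H by (simp add: I_def S_def)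
    ultimately show ?thesis by blast
  qed
  ultimately show ?thesis unfolding graph_free_def by blast
qed

text \<open>Contracting an edge commutes with restricting to an induced subgraph that contains both
  ends: a vertex of \<open>K\<close> is adjacent to \<open>a\<close> or \<open>b\<close> exactly
  when its image is adjacent to \<open>k a\<close> or \<open>k b\<close>. The new vertex goes to the
  new vertex.\<close>

lemma induced_embedding_contract_edge:
  assumes K: "pair_graph K" and k: "induced_embedding k K G" and ab: "(a, b) \<in> parcs K"
  shows "induced_embedding (map_option k) (contract_edge K (a, b)) (contract_edge G (k a, k b))"
proof -
  have ab_verts: "a \<in> pverts K" "b \<in> pverts K" using ab pair_graph_parcs_subset[OF K] by auto
  have inj: "k x = k y \<longleftrightarrow> x = y" if "x \<in> pverts K" "y \<in> pverts K" for x y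
    using k that by (auto simp: induced_embedding_def inj_on_def)
  have arc: "(k x, k y) \<in> parcs G \<longleftrightarrow> (x, y) \<in> parcs K" if "x \<in> pverts K" "y \<in> pverts K" for x y
    using k that by (auto simp: induced_embedding_def)
  have V: "k x \<in> pverts G" if "x \<in> pverts K" for x
    using k that by (auto simp: induced_embedding_def)
  show ?thesis
    unfolding induced_embedding_def
  proof (intro conjI ballI)
    show "inj_on (map_option k) (pverts (contract_edge K (a, b)))"
      by (rule inj_onI) (auto simp: contract_edge_def Let_def inj)
    show "map_option k ` pverts (contract_edge K (a, b)) \<subseteq> pverts (contract_edge G (k a, k b))"
      by (auto simp: contract_edge_def Let_def inj V ab_verts)
    show "(map_option k x, map_option k y) \<in> parcs (contract_edge G (k a, k b)) \<longleftrightarrow>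
        (x, y) \<in> parcs (contract_edge K (a, b))"
      if "x \<in> pverts (contract_edge K (a, b))" "y \<in> pverts (contract_edge K (a, b))" for x y
      using that ab_verts
      by (auto simp: contract_edge_def Let_def neighborhood_def inj arc)
  qed
qed

text \<open>Between old vertices a contraction has the same arcs as \<open>G\<close>, so a copy that
  avoids the new vertex already lies in \<open>G\<close>.\<close>

lemma induced_embedding_the_contract_edge:
  assumes g: "induced_embedding g H (contract_edge G e)" and None: "None \<notin> g ` pverts H"
  shows "induced_embedding (the \<circ> g) H G"
proof -
  obtain u v where e: "e = (u, v)" by (cases e)
  \<comment> \<open>This ensures that \<open>the\<close> is never applied to
    \<open>None\<close>.\<close>
  have Some: "g x = Some (the (g x))" "the (g x) \<in> pverts G - {u, v}" if "x \<in> pverts H" for x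
  proof -
    have "g ` pverts H \<subseteq> insert None (Some ` (pverts G - {u, v}))"
      using g by (simp add: induced_embedding_def contract_edge_def Let_def e)
    then have "g x \<in> insert None (Some ` (pverts G - {u, v}))" "g x \<noteq> None"
      using that None by (blast, force)
    then show "g x = Some (the (g x))" "the (g x) \<in> pverts G - {u, v}" by auto
  qed
  show ?thesis
    unfolding induced_embedding_def
  proof (intro conjI ballI)
    show "inj_on (the \<circ> g) (pverts H)"
    proof (rule inj_onI)
      fix x y assume "x \<in> pverts H" "y \<in> pverts H" "(the \<circ> g) x = (the \<circ> g) y"
      moreover from this have "g x = g y" using Some(1)[of x] Some(1)[of y] by simp
      ultimately show "x = y" using g by (simp add: induced_embedding_def inj_on_def)
    qed
    show "(the \<circ> g) ` pverts H \<subseteq> pverts G" using Some by auto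
    fix x y assume xy: "x \<in> pverts H" "y \<in> pverts H"
    obtain p q where pq: "g x = Some p" "g y = Some q" "p \<notin> {u, v}" "q \<notin> {u, v}"
      using Some xy by blast
    have "(g x, g y) \<in> parcs (contract_edge G e) \<longleftrightarrow> (x, y) \<in> parcs H"
      using g xy by (simp add: induced_embedding_def)
    then show "((the \<circ> g) x, (the \<circ> g) y) \<in> parcs G \<longleftrightarrow> (x, y) \<in> parcs H"
      using pq by (simp add: contract_edge_def Let_def e)
  qed
qed

lemma contraction_graph_free:
  fixes \<H> :: "'h pair_pre_digraph set" and G :: "'a pair_pre_digraph"
  assumes HH: "\<forall>H \<in> \<H>. pair_graph H" and G: "pair_graph G"
    and fs_free: "graph_free (fs \<H>) G" and free: "graph_free \<H> G" and e: "e \<in> parcs G"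
  shows "graph_free \<H> (contract_edge G e)"
proof (rule ccontr)
  interpret G: pair_graph G by fact
  assume "\<not> graph_free \<H> (contract_edge G e)"
  then obtain H g where H: "H \<in> \<H>" and g: "induced_embedding g H (contract_edge G e)"
    using graph_free_iff_no_induced_embedding[OF pair_graph_contract_edge[OF G e] HH] by blast
  have no_emb: "\<not> induced_embedding f H' G" if "H' \<in> \<H>" for H' f
    using free graph_free_iff_no_induced_embedding[OF G HH] that by blast
  have None: "None \<in> g ` pverts H"
    using induced_embedding_the_contract_edge[OF g] no_emb[OF H] by blast
  obtain u v where uv: "e = (u, v)" by (cases e)
  \<comment> \<open>The vertex set of the copy, with the new vertex replaced by \<open>u\<close> and
    \<open>v\<close>.\<close>
  define S where "S = {u, v} \<union> {x. Some x \<in> g ` pverts H}"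
  have g_verts: "g ` pverts H \<subseteq> insert None (Some ` (pverts G - {u, v}))"
    using g by (auto simp: induced_embedding_def contract_edge_def Let_def uv)
  have S: "S \<subseteq> pverts G"
    using g_verts e uv pair_graph_parcs_subset[OF G] by (auto simp: S_def)
  then have fin: "finite S" using G.pair_finite_verts finite_subset by blast
  \<comment> \<open>The members of \<open>fs \<H>\<close> have natural numbers as vertices, so the
    subgraph induced on \<open>S\<close> is transported to an initial segment of the
    naturals.\<close>
  then obtain k where k: "bij_betw k {0..<card S} S"
    using ex_bij_betw_nat_finite by blast
  define T where "T = {0..<card S}"
  define K where "K = \<lparr>pverts = T, parcs = {(x, y). x \<in> T \<and> y \<in> T \<and> (k x, k y) \<in> parcs G}\<rparr>"
  have kT: "k ` T = S" "inj_on k T" using k by (auto simp: T_def bij_betw_def)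
  have K: "pair_graph K"
    unfolding K_def using G S kT by (intro pair_graph_pullback) (auto simp: T_def)
  have kK: "induced_embedding k K G"
    using kT S by (auto simp: induced_embedding_def K_def)
  obtain a b where ab: "a \<in> T" "b \<in> T" "k a = u" "k b = v"
    using kT(1) unfolding S_def by (metis UnCI imageE insertI1 insertI2)
  then have ab_arc: "(a, b) \<in> parcs K" using e uv by (simp add: K_def)
  let ?C = "contract_edge K (a, b)"
  have C: "induced_embedding (map_option k) ?C (contract_edge G e)"
    using induced_embedding_contract_edge[OF K kK ab_arc] ab uv by simp
  have "k ` (T - {a, b}) = S - {u, v}"
    using kT ab by (subst inj_on_image_set_diff[of k T]) auto
  then have "map_option k ` pverts ?C = insert None (Some ` (S - {u, v}))"
    by (simp add: contract_edge_def Let_def K_def image_image flip: image_image[of Some k])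
  \<comment> \<open>One inclusion uses that the copy contains \<open>None\<close>, the other that
    \<open>Some u\<close> and \<open>Some v\<close> are not vertices of the contraction.\<close>
  also have "\<dots> = g ` pverts H"
  proof (intro subset_antisym subsetI)
    fix z assume "z \<in> insert None (Some ` (S - {u, v}))"
    then show "z \<in> g ` pverts H" using None unfolding S_def by blast
  next
    fix z assume "z \<in> g ` pverts H"
    then show "z \<in> insert None (Some ` (S - {u, v}))"
      using g_verts unfolding S_def by (cases z) auto
  qed
  finally have "digraph_iso (with_proj ?C) (with_proj H)"
    using digraph_iso_if_same_image[OF pair_graph_contract_edge[OF K ab_arc] _ C g] H HH by blast
  \<comment> \<open>A member of \<open>\<H>\<close> embedded in \<open>K\<close> would embed in
    \<open>G\<close> by composing with \<open>k\<close>.\<close>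
  moreover have "graph_free \<H> K"
    using graph_free_iff_no_induced_embedding[OF K HH] no_emb induced_embedding_comp[OF _ kK]
    by blast
  ultimately have "K \<in> fs \<H>"
    using K H ab_arc by (auto simp: fs_def free_split_def contractions_def)
  moreover have "\<forall>J \<in> fs \<H>. pair_graph J" by (simp add: fs_def free_split_def)
  ultimately show False
    using fs_free kK graph_free_iff_no_induced_embedding[OF G] by blast
qed

theorem theorem4:
  fixes \<H> :: "'h pair_pre_digraph set" and G :: "'a pair_pre_digraph"
  assumes "\<forall>H \<in> \<H>. pair_graph H"
    and "pair_graph G"
    and "graph_free (fs \<H>) G"
    and "\<not> critically_exist \<H> G"
  shows "graph_free \<H> G \<longleftrightarrow> (\<forall>C \<in> contractions G. graph_free \<H> C)"
proof
  assume "graph_free \<H> G"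
  then show "\<forall>C \<in> contractions G. graph_free \<H> C"
    using contraction_graph_free[OF assms(1-3)] by (auto simp: contractions_def)
next
  assume "\<forall>C \<in> contractions G. graph_free \<H> C"
  then show "graph_free \<H> G"
    using assms(4) by (simp add: critically_exist_def graph_exist_def)
qed

end
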